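(* Let $G$ be a group and let $X$ be a finite $G$-set. Then (1) $L(X)=L^G(X)\operatorname{\perp\!\!\!\!\oplus} L^G(X)^\perp$; (2) $L(X)=\mathrm{span}\,f_1\operatorname{\perp\!\!\!\!\oplus}\ker\sigma$; (3) $L^G(X)=\mathrm{span}\,f_1\operatorname{\perp\!\!\!\!\oplus}\ker\left(\sigma|_{L^G(X)}\right)$. Here the symbol $\operatorname{\perp\!\!\!\!\oplus}$ denotes orthogonal direct sum decomposition: the space on the left is the internal direct sum of the two subspaces on the right, and these are orthogonal to each other.
   Context: A $G$-set is a nonempty set $X$ with an action of the group $G$ (here $G$ may be finite or infinite), written $a\cdot x$. $L(X)$ is the complex vector space of all functions $X\to\mathbb{C}$ with pointwise operations, with Hermitian inner product $\langle f,g\rangle=\frac{1}{|X|}\sum_{x\in X}f(x)\overline{g(x)}$; orthogonal complements $^\perp$ are taken in $L(X)$. $L^G(X)=\{f\in L(X)\colon f(a\cdot x)=f(x)\text{ for all }a\in G,x\in X\}$. $f_1\in L(X)$ is the constant function $f_1(x)=1$. The map $\sigma\colon L(X)\to\mathbb{C}$ is the linear functional $\sigma(f)=\sum_{x\in X}f(x)$, and $\sigma|_{L^G(X)}$ is its restriction to $L^G(X)$. *)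

theory Defs
  imports Complex_Main "HOL-Library.Function_Algebras" "HOL-Library.Set_Algebras"
    "HOL-Algebra.Group_Action"
begin

text \<open>
  A function \<open>X \<rightarrow> \<complex>\<close> on a set \<open>X\<close> is represented by its extension by \<open>0\<close> to the whole type.
  On this representation the operations of \<^theory>\<open>HOL-Library.Function_Algebras\<close> are the
  pointwise operations of \<open>L(X)\<close>, so \<open>L(X)\<close> is a subspace of the full function space.
\<close>

definition fun_scale :: "complex \<Rightarrow> ('x \<Rightarrow> complex) \<Rightarrow> 'x \<Rightarrow> complex"
  where "fun_scale c f = (\<lambda>x. c * f x)"

interpretation cfun: vector_space fun_scale
  by unfold_locales (auto simp: fun_scale_def fun_eq_iff algebra_simps)

definition fun_space :: "'x set \<Rightarrow> ('x \<Rightarrow> complex) set"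
  where "fun_space X = {f. \<forall>x. x \<notin> X \<longrightarrow> f x = 0}"

lemma subspace_fun_space: "cfun.subspace (fun_space X)"
  by (auto simp: cfun.subspace_def fun_space_def fun_scale_def)

definition fun_inner :: "'x set \<Rightarrow> ('x \<Rightarrow> complex) \<Rightarrow> ('x \<Rightarrow> complex) \<Rightarrow> complex"
  where "fun_inner X f g = 1 / of_nat (card X) * (\<Sum>x\<in>X. f x * cnj (g x))"

definition orth_complement :: "'x set \<Rightarrow> ('x \<Rightarrow> complex) set \<Rightarrow> ('x \<Rightarrow> complex) set"
  where "orth_complement X W = {f \<in> fun_space X. \<forall>g\<in>W. fun_inner X f g = 0}"

definition invariant_fun_space ::
    "('g, 'm) monoid_scheme \<Rightarrow> 'x set \<Rightarrow> ('g \<Rightarrow> 'x \<Rightarrow> 'x) \<Rightarrow> ('x \<Rightarrow> complex) set"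
  where "invariant_fun_space G X \<phi> =
    {f \<in> fun_space X. \<forall>a\<in>carrier G. \<forall>x\<in>X. f (\<phi> a x) = f x}"

definition fun_one :: "'x set \<Rightarrow> 'x \<Rightarrow> complex"
  where "fun_one X = (\<lambda>x. if x \<in> X then 1 else 0)"

definition fun_sum :: "'x set \<Rightarrow> ('x \<Rightarrow> complex) \<Rightarrow> complex"
  where "fun_sum X f = (\<Sum>x\<in>X. f x)"

text \<open>The kernel of the restriction of \<open>l\<close> to the subspace \<open>V\<close>.\<close>

definition kernel_on :: "('x \<Rightarrow> complex) set \<Rightarrow> (('x \<Rightarrow> complex) \<Rightarrow> complex) \<Rightarrow> ('x \<Rightarrow> complex) set"
  where "kernel_on V l = {f \<in> V. l f = 0}"

text \<open>Here \<open>A + B\<close> is the elementwise sum of sets from \<^theory>\<open>HOL-Library.Set_Algebras\<close>.\<close>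

definition orth_direct_sum ::
    "'x set \<Rightarrow> ('x \<Rightarrow> complex) set \<Rightarrow> ('x \<Rightarrow> complex) set \<Rightarrow> ('x \<Rightarrow> complex) set \<Rightarrow> bool"
  where "orth_direct_sum X V A B \<longleftrightarrow>
    cfun.subspace A \<and> cfun.subspace B \<and> V = A + B \<and> A \<inter> B = {0} \<and>
    (\<forall>f\<in>A. \<forall>g\<in>B. fun_inner X f g = 0)"

end

(* The orthogonal projection onto the invariant functions is averaging over orbits, and the
   orthogonal projection onto the constants is averaging over X. *)

theory Submission
  imports Defs
begin

text \<open>Each decomposition comes from an explicit orthogonal projection: if every f in V has
  some p in A with f - p in B, and A and B are orthogonal, then V = A + B, and the sum is direct
  because the inner product is positive definite on \<open>fun_space X\<close>
  (\<open>orth_direct_sumI\<close>). For invariant functions, p is the average of f over orbits.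
  Averaging does not change the inner product with an invariant g, since g is constant on orbits
  (\<open>fun_inner_orbit_average\<close>), so f - p is orthogonal to all such g. For constants, p
  is the mean value of f. The inner product with \<open>fun_one X\<close> is the sum functional up
  to conjugation and scaling, so its kernel is the complement of the constants. This works in any
  subspace of \<open>fun_space X\<close> containing \<open>fun_one X\<close> and so gives both
  remaining claims (\<open>orth_direct_sum_constants\<close>).\<close>

lemma fun_inner_add_left: "fun_inner X (f + g) h = fun_inner X f h + fun_inner X g h"
  by (simp add: fun_inner_def distrib_right sum.distrib add_divide_distrib)

lemma fun_inner_diff_left: "fun_inner X (f - g) h = fun_inner X f h - fun_inner X g h"
  by (simp add: fun_inner_def left_diff_distrib sum_subtractf diff_divide_distrib)

lemma fun_inner_scale_left: "fun_inner X (fun_scale c f) g = c * fun_inner X f g"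
  by (simp add: fun_inner_def fun_scale_def sum_distrib_left mult.assoc mult.left_commute)

lemma fun_inner_commute: "fun_inner X f g = cnj (fun_inner X g f)"
  by (simp add: fun_inner_def mult.commute)

text \<open>Identifies the kernel of the sum functional with the functions orthogonal to the
  constants.\<close>

lemma fun_inner_fun_one_left: "fun_inner X (fun_one X) f = cnj (fun_sum X f) / of_nat (card X)"
  by (simp add: fun_inner_def fun_one_def fun_sum_def)

lemma fun_inner_self_eq_0:
  assumes "finite X" "f \<in> fun_space X" "fun_inner X f f = 0"
  shows "f = 0"
proof
  fix x
  show "f x = 0 x"
  proof (cases "x \<in> X")
    case True
    \<comment> \<open>The point x shows that X is nonempty, so the factor 1 / \<open>card X\<close>
      is nonzero and cancels.\<close>
    have "(\<Sum>x\<in>X. f x * cnj (f x)) = 0"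
      using assms True by (auto simp: fun_inner_def)
    then have "complex_of_real (\<Sum>x\<in>X. (cmod (f x))\<^sup>2) = 0"
      by (simp add: complex_norm_square del: of_real_power)
    then have "(\<Sum>x\<in>X. (cmod (f x))\<^sup>2) = 0"
      by (simp only: of_real_eq_0_iff)
    with assms(1) True show ?thesis
      by (simp add: sum_nonneg_eq_0_iff)
  qed (use assms(2) in \<open>simp add: fun_space_def\<close>)
qed

lemma subspace_orth_complement: "cfun.subspace (orth_complement X W)"
  using subspace_fun_space[of X]
  by (auto simp: cfun.subspace_def orth_complement_def fun_inner_add_left fun_inner_scale_left)
    (simp add: fun_inner_def)

lemma subspace_invariant_fun_space: "cfun.subspace (invariant_fun_space G X \<phi>)"
  using subspace_fun_space[of X]
  by (auto simp: cfun.subspace_def invariant_fun_space_def fun_scale_def)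

lemma subspace_kernel_fun_sum:
  assumes "cfun.subspace V"
  shows "cfun.subspace (kernel_on V (fun_sum X))"
  using assms
  by (auto simp: cfun.subspace_def kernel_on_def fun_sum_def fun_scale_def sum.distrib
      simp flip: sum_distrib_left)

lemma orth_direct_sumI:
  assumes "finite X" "cfun.subspace V" "cfun.subspace A" "cfun.subspace B"
    and "A \<subseteq> V" "B \<subseteq> V" "V \<subseteq> fun_space X"
    and orth: "\<And>f g. f \<in> A \<Longrightarrow> g \<in> B \<Longrightarrow> fun_inner X f g = 0"
    and proj: "\<And>f. f \<in> V \<Longrightarrow> \<exists>p\<in>A. f - p \<in> B"
  shows "orth_direct_sum X V A B"
proof -
  have "V \<subseteq> A + B"
  proof
    fix f assume "f \<in> V"
    then obtain p where "p \<in> A" "f - p \<in> B"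
      using proj by blast
    then have "p + (f - p) \<in> A + B"
      by (rule set_plus_intro)
    then show "f \<in> A + B" by simp
  qed
  moreover have "A + B \<subseteq> V"
    using assms by (auto elim!: set_plus_elim intro: cfun.subspace_add)
  \<comment> \<open>A common element is orthogonal to itself, hence zero.\<close>
  moreover have "A \<inter> B \<subseteq> {0}"
    using assms fun_inner_self_eq_0[OF \<open>finite X\<close>] by blast
  moreover have "0 \<in> A \<inter> B"
    using assms by (simp add: cfun.subspace_0)
  ultimately show ?thesis
    unfolding orth_direct_sum_def using assms by blast
qed

lemma orth_direct_sum_constants:
  assumes "finite X" "X \<noteq> {}" "cfun.subspace V" "V \<subseteq> fun_space X" "fun_one X \<in> V"
  shows "orth_direct_sum X V (cfun.span {fun_one X}) (kernel_on V (fun_sum X))"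
proof (rule orth_direct_sumI)
  show "cfun.span {fun_one X} \<subseteq> V"
    using assms by (simp add: cfun.span_minimal)
  show "fun_inner X f g = 0"
    if "f \<in> cfun.span {fun_one X}" "g \<in> kernel_on V (fun_sum X)" for f g
    using that
    by (auto simp: cfun.span_singleton fun_inner_scale_left fun_inner_fun_one_left kernel_on_def)
  show "\<exists>p\<in>cfun.span {fun_one X}. f - p \<in> kernel_on V (fun_sum X)" if "f \<in> V" for f
  proof
    \<comment> \<open>The coefficient is the mean of f: \<open>fun_one X\<close> sums to
      \<open>card X\<close>, so f and \<open>?p\<close> have equal sums.\<close>
    let ?p = "fun_scale (fun_sum X f / of_nat (card X)) (fun_one X)"
    show "?p \<in> cfun.span {fun_one X}"
      by (auto simp: cfun.span_singleton)
    have "fun_sum X (f - ?p) = 0"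
      using assms by (simp add: fun_sum_def fun_scale_def fun_one_def sum_subtractf)
    moreover have "f - ?p \<in> V"
      using assms that by (simp add: cfun.subspace_diff cfun.subspace_scale)
    ultimately show "f - ?p \<in> kernel_on V (fun_sum X)"
      by (simp add: kernel_on_def)
  qed
qed (use assms subspace_kernel_fun_sum[of V X] in \<open>simp_all, auto simp: kernel_on_def\<close>)

text \<open>Averaging over the orbit instead of over G makes sense for infinite G as well, since
  orbits in a finite set are finite.\<close>

definition orbit_average ::
    "('g, 'm) monoid_scheme \<Rightarrow> 'x set \<Rightarrow> ('g \<Rightarrow> 'x \<Rightarrow> 'x) \<Rightarrow> ('x \<Rightarrow> complex) \<Rightarrow> 'x \<Rightarrow> complex"
  where "orbit_average G X \<phi> f =
    (\<lambda>x. if x \<in> X then (\<Sum>y\<in>orbit G \<phi> x. f y) / of_nat (card (orbit G \<phi> x)) else 0)"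

context group_action
begin

lemma orbit_subset: "x \<in> E \<Longrightarrow> orbit G \<phi> x \<subseteq> E"
  using element_image by (auto simp: orbit_def)

lemma orbit_eq:
  assumes "x \<in> E" "y \<in> orbit G \<phi> x"
  shows "orbit G \<phi> y = orbit G \<phi> x"
proof -
  have y: "y \<in> E"
    using assms orbit_subset by blast
  then have x: "x \<in> orbit G \<phi> y"
    using assms orbit_sym by blast
  show ?thesis
  proof
    show "orbit G \<phi> y \<subseteq> orbit G \<phi> x"
      using orbit_trans[OF assms(1) y _ assms(2)] orbit_subset[OF y] by blast
    show "orbit G \<phi> x \<subseteq> orbit G \<phi> y"
      using orbit_trans[OF y assms(1) _ x] orbit_subset[OF assms(1)] by blast
  qed
qed

lemma invariant_on_orbit:
  assumes "f \<in> invariant_fun_space G E \<phi>" "x \<in> E" "y \<in> orbit G \<phi> x"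
  shows "f y = f x"
  using assms by (auto simp: invariant_fun_space_def orbit_def)

text \<open>The average at x depends only on the orbit of x, and acting on x does not change that
  orbit.\<close>

lemma orbit_average_in_invariant: "orbit_average G E \<phi> f \<in> invariant_fun_space G E \<phi>"
proof -
  have "\<phi> a x \<in> E" "orbit G \<phi> (\<phi> a x) = orbit G \<phi> x" if "a \<in> carrier G" "x \<in> E" for a x
  proof -
    show "\<phi> a x \<in> E"
      using that element_image by blast
    have "\<phi> a x \<in> orbit G \<phi> x"
      using that by (auto simp: orbit_def)
    with that(2) show "orbit G \<phi> (\<phi> a x) = orbit G \<phi> x"
      by (rule orbit_eq)
  qed
  then show ?thesis
    by (simp add: invariant_fun_space_def fun_space_def orbit_average_def)
qed

text \<open>Expanding the average gives a sum over pairs of points in a common orbit, weighted by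
  the inverse orbit size. On such pairs both g and the orbit size agree, so averaging can be removed
  by exchanging the summations.\<close>

lemma fun_inner_orbit_average:
  assumes "finite E" "g \<in> invariant_fun_space G E \<phi>"
  shows "fun_inner E (orbit_average G E \<phi> f) g = fun_inner E f g"
proof -
  let ?O = "orbit G \<phi>"
  \<comment> \<open>Orbits are written as filtered subsets of E to match the form of
    \<open>sum.swap_restrict\<close>.\<close>
  have restrict: "?O x = {y \<in> E. y \<in> ?O x}" if "x \<in> E" for x
    using orbit_subset that by blast
  have mem_sym: "x \<in> ?O y \<longleftrightarrow> y \<in> ?O x" if "x \<in> E" "y \<in> E" for x y
    using orbit_sym that by blast
  have card: "card (?O x) \<noteq> 0" if "x \<in> E" for x
    using that assms(1) orbit_subset orbit_refl finite_subset by (metis card_eq_0_iff empty_iff)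
  have "(\<Sum>x\<in>E. orbit_average G E \<phi> f x * cnj (g x))
      = (\<Sum>x\<in>E. \<Sum>y\<in>?O x. f y * cnj (g x) / of_nat (card (?O x)))"
    by (intro sum.cong) (simp_all add: orbit_average_def sum_distrib_right sum_divide_distrib)
  also have "\<dots> = (\<Sum>x\<in>E. \<Sum>y | y \<in> E \<and> y \<in> ?O x. f y * cnj (g x) / of_nat (card (?O x)))"
    using restrict by (intro sum.cong) auto
  also have "\<dots> = (\<Sum>y\<in>E. \<Sum>x | x \<in> E \<and> y \<in> ?O x. f y * cnj (g x) / of_nat (card (?O x)))"
    using assms(1) by (intro sum.swap_restrict)
  \<comment> \<open>By symmetry, the x whose orbit contains y form the orbit of y; there
    \<open>g x\<close> and \<open>card (?O x)\<close> take their values at y.\<close>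
  also have "\<dots> = (\<Sum>y\<in>E. \<Sum>x\<in>?O y. f y * cnj (g y) / of_nat (card (?O y)))"
  proof (intro sum.cong refl)
    fix y x assume "y \<in> E"
    then show "{x \<in> E. y \<in> ?O x} = ?O y"
      using mem_sym restrict by blast
    assume "x \<in> ?O y"
    then show "f y * cnj (g x) / of_nat (card (?O x)) = f y * cnj (g y) / of_nat (card (?O y))"
      using invariant_on_orbit[OF assms(2) \<open>y \<in> E\<close>] orbit_eq[OF \<open>y \<in> E\<close>] by simp
  qed
  \<comment> \<open>The inner sum has \<open>card (?O y)\<close> equal terms, which cancels the
    nonzero denominator.\<close>
  also have "\<dots> = (\<Sum>y\<in>E. f y * cnj (g y))"
    using card by (intro sum.cong) simp_all
  finally show ?thesis
    by (simp add: fun_inner_def)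
qed

lemma orth_direct_sum_invariant:
  assumes "finite E"
  shows "orth_direct_sum E (fun_space E)
    (invariant_fun_space G E \<phi>) (orth_complement E (invariant_fun_space G E \<phi>))"
proof (rule orth_direct_sumI)
  show "fun_inner E f g = 0"
    if "f \<in> invariant_fun_space G E \<phi>" "g \<in> orth_complement E (invariant_fun_space G E \<phi>)" for f g
    \<comment> \<open>The complement is defined with the invariant function in the second argument,
      so the arguments are swapped first.\<close>
    using that by (subst fun_inner_commute) (simp add: orth_complement_def)
  show "\<exists>p\<in>invariant_fun_space G E \<phi>. f - p \<in> orth_complement E (invariant_fun_space G E \<phi>)"
    if "f \<in> fun_space E" for f
  proof
    show "orbit_average G E \<phi> f \<in> invariant_fun_space G E \<phi>"
      by (rule orbit_average_in_invariant)
    then have "f - orbit_average G E \<phi> f \<in> fun_space E"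
      using that by (simp add: invariant_fun_space_def cfun.subspace_diff subspace_fun_space)
    then show "f - orbit_average G E \<phi> f \<in> orth_complement E (invariant_fun_space G E \<phi>)"
      by (simp add: orth_complement_def fun_inner_diff_left fun_inner_orbit_average assms)
  qed
qed (simp_all add: assms subspace_fun_space subspace_invariant_fun_space subspace_orth_complement,
    auto simp: invariant_fun_space_def orth_complement_def)

lemma fun_one_invariant: "fun_one E \<in> invariant_fun_space G E \<phi>"
  using element_image by (auto simp: invariant_fun_space_def fun_space_def fun_one_def)

end

theorem corollary3p9:
  fixes G :: "('g, 'm) monoid_scheme" and X :: "'x set" and \<phi> :: "'g \<Rightarrow> 'x \<Rightarrow> 'x"
  assumes "group G"
    and "group_action G X \<phi>"
    and "finite X" and "X \<noteq> {}"
  shows "orth_direct_sum X (fun_space X)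
           (invariant_fun_space G X \<phi>) (orth_complement X (invariant_fun_space G X \<phi>)) \<and>
         orth_direct_sum X (fun_space X)
           (cfun.span {fun_one X}) (kernel_on (fun_space X) (fun_sum X)) \<and>
         orth_direct_sum X (invariant_fun_space G X \<phi>)
           (cfun.span {fun_one X}) (kernel_on (invariant_fun_space G X \<phi>) (fun_sum X))"
proof (intro conjI)
  interpret group_action G X \<phi> by fact
  show "orth_direct_sum X (fun_space X)
      (invariant_fun_space G X \<phi>) (orth_complement X (invariant_fun_space G X \<phi>))"
    using \<open>finite X\<close> by (rule orth_direct_sum_invariant)
  show "orth_direct_sum X (fun_space X)
      (cfun.span {fun_one X}) (kernel_on (fun_space X) (fun_sum X))"
    using assms
    by (intro orth_direct_sum_constants subspace_fun_space) (auto simp: fun_space_def fun_one_def)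
  show "orth_direct_sum X (invariant_fun_space G X \<phi>)
      (cfun.span {fun_one X}) (kernel_on (invariant_fun_space G X \<phi>) (fun_sum X))"
    using assms fun_one_invariant
    by (intro orth_direct_sum_constants subspace_invariant_fun_space)
      (auto simp: invariant_fun_space_def)
qed

end
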